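(* There exists an absolute constant $c>0$ with the following property. Let $(\eta_R)_{R\ge 1}$ be positive real numbers with $\eta_R\to 0$ as $R\to\infty$ and such that $\mu_R\in\mathcal{H}_R(\eta_R)$ for all sufficiently large $R$. Then for all sufficiently large $R$: if there is a (possibly randomized) learning algorithm which, given $m$ labeled samples $(n_i,h^*(n_i))$, $1\le i\le m$, with $n_1,\dots,n_m$ drawn independently from a probability distribution $\mathcal D$ on $X_R'$ (unknown to the algorithm), outputs a hypothesis $\hat h:X_R'\to\{-1,1\}$ such that, for every probability distribution $\mathcal D$ on $X_R'$, \[ \sup_{h^*\in\mathcal{H}_R(\eta_R)}\mathbb{P}\left(\operatorname{error}(\hat h)\ge\frac14\right)\le\frac13, \] then $m\ge cR$.
   Context: $\mu$ denotes the classical Möbius function: $\mu(1)=1$, $\mu(n)=0$ if $n$ is not squarefree, and $\mu(n)=(-1)^k$ if $n$ is squarefree with $k$ prime factors. For an integer $R\ge1$ let $X_R=\{1,2,\dots,R\}$ and $X_R'=\{n\le R:\mu(n)\ne0\}$, and let $\mu_R:X_R'\to\{-1,1\}$ be the restriction of $\mu$ to $X_R'$. A function $f:X_R'\to\{-1,1\}$ is extended to $X_R$ by setting $f(n)=0$ for $n\notin X_R'$. Its Fourier transform is $\widehat f(x)=\sum_{n=1}^R f(n)e^{-2\pi i n x}$, $x\in[0,1]$, and its Fourier Ratio is \[ \operatorname{FR}(f)=\frac{\|\widehat f\|_{L^1([0,1])}}{\|\widehat f\|_{L^2([0,1])}}, \] with norms taken with respect to Lebesgue measure on $[0,1]$.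 For $\eta>0$, $\mathcal H_R(\eta)=\{f:X_R'\to\{-1,1\}:\operatorname{FR}(f)\ge\eta\}$. A (possibly randomized) learning algorithm with $m$ samples is a map assigning to each element of $(X_R'\times\{-1,1\})^m$ a probability distribution on functions $X_R'\to\{-1,1\}$, from which the output $\hat h$ is drawn; it does not depend on $\mathcal D$ or on the target $h^*$ other than through the samples. For a target $h^*$ and distribution $\mathcal D$, $\operatorname{error}(h)=\mathbb P_{n\sim\mathcal D}(h(n)\ne h^*(n))$. The probability $\mathbb P$ in the success condition is over the random samples and the internal randomness of the algorithm. *)

theory Defs
  imports
    "HOL-Probability.Probability"
    "HOL-Computational_Algebra.Computational_Algebra"
begin

definition moebius :: "nat \<Rightarrow> int" where
  "moebius n = (if squarefree n then (- 1) ^ card (prime_factors n) else 0)"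

definition X' :: "nat \<Rightarrow> nat set" where
  "X' R = {n. 1 \<le> n \<and> n \<le> R \<and> moebius n \<noteq> 0}"

text \<open>
  Functions from \<open>X' R\<close> to \<open>{-1, 1}\<close> are represented extensionally, that is, with the fixed
  value \<open>undefined\<close> outside \<open>X' R\<close>; the extension by zero is a separate operation.
\<close>

definition sign_functions :: "nat \<Rightarrow> (nat \<Rightarrow> int) set" where
  "sign_functions R = X' R \<rightarrow>\<^sub>E {-1, 1}"

definition moebius_restr :: "nat \<Rightarrow> nat \<Rightarrow> int" where
  "moebius_restr R = restrict moebius (X' R)"

definition extend_zero :: "nat \<Rightarrow> (nat \<Rightarrow> int) \<Rightarrow> nat \<Rightarrow> int" where
  "extend_zero R f n = (if n \<in> X' R then f n else 0)"

definition fourier :: "nat \<Rightarrow> (nat \<Rightarrow> int) \<Rightarrow> real \<Rightarrow> complex" where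
  "fourier R f x =
     (\<Sum>n=1..R. of_int (extend_zero R f n) * exp (- 2 * of_real pi * \<i> * of_nat n * of_real x))"

definition L1_norm :: "(real \<Rightarrow> complex) \<Rightarrow> real" where
  "L1_norm g = (LINT x:{0..1}|lborel. norm (g x))"

definition L2_norm :: "(real \<Rightarrow> complex) \<Rightarrow> real" where
  "L2_norm g = sqrt (LINT x:{0..1}|lborel. (norm (g x))\<^sup>2)"

definition FR :: "nat \<Rightarrow> (nat \<Rightarrow> int) \<Rightarrow> real" where
  "FR R f = L1_norm (fourier R f) / L2_norm (fourier R f)"

definition hypotheses :: "nat \<Rightarrow> real \<Rightarrow> (nat \<Rightarrow> int) set" where
  "hypotheses R \<eta> = {f \<in> sign_functions R. FR R f \<ge> \<eta>}"

text \<open>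
  A sample of size \<open>m\<close> is a list of length \<open>m\<close>. The sets of samples and of sign functions
  are finite, so probability mass functions cover all output distributions. The values of
  the algorithm on lists that are not samples of size \<open>m\<close> are irrelevant.
\<close>

definition samples :: "nat \<Rightarrow> nat \<Rightarrow> (nat \<times> int) list set" where
  "samples R m = {s. length s = m \<and> set s \<subseteq> X' R \<times> {-1, 1}}"

definition learning_algorithm ::
    "nat \<Rightarrow> nat \<Rightarrow> ((nat \<times> int) list \<Rightarrow> (nat \<Rightarrow> int) pmf) \<Rightarrow> bool" where
  "learning_algorithm R m A \<longleftrightarrow> (\<forall>s\<in>samples R m. set_pmf (A s) \<subseteq> sign_functions R)"

definition error :: "nat pmf \<Rightarrow> (nat \<Rightarrow> int) \<Rightarrow> (nat \<Rightarrow> int) \<Rightarrow> real" where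
  "error D target h = measure_pmf.prob D {n. h n \<noteq> target n}"

text \<open>
  The law of the output hypothesis, over both the \<open>m\<close> independent samples from \<open>D\<close>
  and the internal randomness of the algorithm.
\<close>

definition output_law ::
    "nat \<Rightarrow> ((nat \<times> int) list \<Rightarrow> (nat \<Rightarrow> int) pmf) \<Rightarrow> nat pmf \<Rightarrow> (nat \<Rightarrow> int) \<Rightarrow> (nat \<Rightarrow> int) pmf"
  where
  "output_law m A D target =
     bind_pmf (replicate_pmf m D) (\<lambda>ns. A (map (\<lambda>n. (n, target n)) ns))"

end

theory Submission
  imports Defs
begin

text \<open>
  A class shattering a set \<open>A\<close> cannot be learned from \<open>card A / 2\<close> samples: take
  the uniform distribution on \<open>A\<close> and flip the labels of the unseen points, at least half of
  \<open>A\<close>. This leaves the sample unchanged, and of the two targets at least one differs from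
  any given hypothesis on a quarter of \<open>A\<close>. So the failure probability, averaged over all
  labellings, is at least \<open>1/2\<close>.

  Every subset \<open>A\<close> of at most half of \<open>X' R\<close> is shattered by the functions of
  Fourier ratio at least \<open>1/4\<close>: fix the labels on \<open>A\<close> and choose random signs on the
  complement. By Khintchine's inequality the mean of the \<open>L\<^sup>1\<close> norm is at least a constant times the
  square root of \<open>card (X' R)\<close>, which by Parseval is the \<open>L\<^sup>2\<close> norm. Finally, since the inverse
  squares of \<open>2, 3, \<dots>\<close> sum to at most \<open>3/4\<close>, at least a quarter of the integers up to
  \<open>R\<close> are squarefree.
\<close>

section \<open>Random signed sums and Khintchine's inequality\<close>

definition signs :: "'a set \<Rightarrow> 'a \<Rightarrow> int" where
  "signs S n = (if n \<in> S then 1 else - 1)"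

text \<open>A sign pattern on \<open>B\<close> is encoded by the set \<open>S\<close> of points with
  sign +1, so an expectation over independent uniform signs is \<open>2 ^ card B\<close> times
  smaller than the corresponding sum over \<open>Pow B\<close>.\<close>

definition signed_sum :: "('a \<Rightarrow> complex) \<Rightarrow> 'a set \<Rightarrow> 'a set \<Rightarrow> complex" where
  "signed_sum z B S = (\<Sum>n\<in>B. of_int (signs S n) * z n)"

lemma ex_ge_average_Pow:
  fixes f :: "'a set \<Rightarrow> real"
  assumes "finite B" "2 ^ card B * c \<le> (\<Sum>S\<in>Pow B. f S)"
  shows "\<exists>S\<subseteq>B. c \<le> f S"
proof (rule ccontr)
  assume "\<not> ?thesis"
  then have "(\<Sum>S\<in>Pow B. f S) < (\<Sum>S\<in>Pow B. c)"
    using assms(1) by (intro sum_strict_mono) (auto simp: not_le)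
  then show False
    using assms by (simp add: card_Pow)
qed

lemma sum_Pow_insert:
  fixes g :: "'a set \<Rightarrow> 'b::comm_monoid_add"
  assumes "finite B" "b \<notin> B"
  shows "(\<Sum>S\<in>Pow (insert b B). g S) = (\<Sum>S\<in>Pow B. g S + g (insert b S))"
proof -
  have "inj_on (insert b) (Pow B)"
    using assms(2) by (auto simp: inj_on_def)
  moreover have "Pow B \<inter> insert b ` Pow B = {}"
    using assms(2) by auto
  ultimately show ?thesis
    unfolding Pow_insert using assms(1)
    by (simp add: sum.union_disjoint sum.reindex sum.distrib)
qed

lemma signed_sum_insert:
  assumes "finite B" "b \<notin> B" "S \<subseteq> B"
  shows "signed_sum z (insert b B) S = signed_sum z B S - z b"
    and "signed_sum z (insert b B) (insert b S) = signed_sum z B S + z b"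
proof -
  have "signs (insert b S) n = signs S n" if "n \<in> B" for n
    using that assms(2) by (auto simp: signs_def)
  then show "signed_sum z (insert b B) S = signed_sum z B S - z b"
    "signed_sum z (insert b B) (insert b S) = signed_sum z B S + z b"
    using assms by (auto simp: signed_sum_def signs_def)
qed

lemma signed_sum_Compl:
  assumes "S \<subseteq> B"
  shows "signed_sum z B (B - S) = - signed_sum z B S"
  unfolding signed_sum_def sum_negf[symmetric]
  by (rule sum.cong) (auto simp: signs_def)

text \<open>With \<open>p\<close> the squared norm of \<open>s\<close> and \<open>q\<close> twice
  the inner product, the left side equals 2(p + 1)^2 + 2q^2, and Cauchy-Schwarz gives q^2 \<le> 4p.
  This drives the induction for the fourth moment.\<close>

lemma norm_power4_add_le:
  fixes s w :: complex
  assumes "norm w = 1"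
  shows "norm (s - w) ^ 4 + norm (s + w) ^ 4 \<le> 2 * norm s ^ 4 + 12 * (norm s)\<^sup>2 + 2"
proof -
  define p where "p = (norm s)\<^sup>2"
  define q where "q = 2 * (s \<bullet> w)"
  have 1: "(norm (s + w))\<^sup>2 = p + q + 1" "(norm (s - w))\<^sup>2 = p - q + 1"
    using assms unfolding p_def q_def
    by (simp_all add: power2_norm_eq_inner algebra_simps inner_commute norm_eq_1)
  have "\<bar>s \<bullet> w\<bar> \<le> norm s"
    using Cauchy_Schwarz_ineq2[of s w] assms by simp
  then have "(s \<bullet> w)\<^sup>2 \<le> p"
    unfolding p_def by (metis abs_ge_zero power2_abs power_mono)
  then have "q\<^sup>2 \<le> 4 * p"
    unfolding q_def by (simp add: power_mult_distrib)
  moreover have "norm (s - w) ^ 4 + norm (s + w) ^ 4 = (p - q + 1)\<^sup>2 + (p + q + 1)\<^sup>2"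
    unfolding 1[symmetric] by (simp flip: power_mult)
  moreover have "norm s ^ 4 = p\<^sup>2"
    unfolding p_def by (simp flip: power_mult)
  ultimately show ?thesis
    unfolding p_def[symmetric] by (simp add: power2_eq_square algebra_simps)
qed

text \<open>By the parallelogram law, the two signs of a new unit vector together turn the squared
  norm |s|^2 into 2|s|^2 + 2.\<close>

lemma sum_signed_sum_power2:
  assumes "finite B" "\<And>n. n \<in> B \<Longrightarrow> norm (z n) = 1"
  shows "(\<Sum>S\<in>Pow B. (norm (signed_sum z B S))\<^sup>2) = 2 ^ card B * real (card B)"
  using assms
proof (induction B)
  case empty
  then show ?case by (simp add: signed_sum_def)
next
  case (insert b B)
  have "(norm (s - z b))\<^sup>2 + (norm (s + z b))\<^sup>2 = 2 * (norm s)\<^sup>2 + 2" for s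
    using insert.prems[of b]
    by (simp add: power2_norm_eq_inner algebra_simps inner_commute norm_eq_1)
  then have "(\<Sum>S\<in>Pow (insert b B). (norm (signed_sum z (insert b B) S))\<^sup>2)
      = (\<Sum>S\<in>Pow B. 2 * (norm (signed_sum z B S))\<^sup>2 + 2)"
    unfolding sum_Pow_insert[OF insert.hyps] using insert.hyps
    by (intro sum.cong) (simp_all add: signed_sum_insert)
  then show ?case
    using insert by (simp add: sum.distrib card_Pow algebra_simps flip: sum_distrib_left)
qed

lemma sum_signed_sum_power4_le:
  assumes "finite B" "\<And>n. n \<in> B \<Longrightarrow> norm (z n) = 1"
  shows "(\<Sum>S\<in>Pow B. norm (signed_sum z B S) ^ 4) \<le> 2 ^ card B * (3 * (real (card B))\<^sup>2)"
  using assms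
proof (induction B)
  case empty
  then show ?case by (simp add: signed_sum_def)
next
  case (insert b B)
  have "(\<Sum>S\<in>Pow (insert b B). norm (signed_sum z (insert b B) S) ^ 4)
      \<le> (\<Sum>S\<in>Pow B. 2 * norm (signed_sum z B S) ^ 4 + 12 * (norm (signed_sum z B S))\<^sup>2 + 2)"
    unfolding sum_Pow_insert[OF insert.hyps] using insert.hyps insert.prems
    by (intro sum_mono) (simp add: signed_sum_insert norm_power4_add_le)
  also have "\<dots> = 2 * (\<Sum>S\<in>Pow B. norm (signed_sum z B S) ^ 4)
      + 12 * (2 ^ card B * real (card B)) + 2 * 2 ^ card B"
    using insert by (simp add: sum.distrib card_Pow sum_signed_sum_power2 flip: sum_distrib_left)
  also have "\<dots> \<le> 2 * (2 ^ card B * (3 * (real (card B))\<^sup>2))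
      + 12 * (2 ^ card B * real (card B)) + 2 * 2 ^ card B"
    using insert by simp
  \<comment> \<open>With k = \<open>card B\<close>, dividing by \<open>2 ^ k\<close> leaves 6k^2 +
    12k + 2 \<le> 6(k + 1)^2.\<close>
  also have "\<dots> \<le> 2 ^ card (insert b B) * (3 * (real (card (insert b B)))\<^sup>2)"
    using insert.hyps by (simp add: power2_eq_square algebra_simps)
  finally show ?case .
qed

text \<open>The quartic touches the identity at \<open>s = 2\<close>; averaging it turns the second and
  fourth moments of a random signed sum into a lower bound for the first.\<close>

lemma tangent_bound:
  fixes s :: real
  assumes "s \<ge> 0"
  shows "s \<ge> 3 / 4 * s\<^sup>2 - s ^ 4 / 16"
proof -
  have "s - (3 / 4 * s\<^sup>2 - s ^ 4 / 16) = s * (s - 2)\<^sup>2 * (s + 4) / 16"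
    by (simp add: power2_eq_square power4_eq_xxxx algebra_simps)
  moreover have "\<dots> \<ge> 0"
    using assms by simp
  ultimately show ?thesis by linarith
qed

lemma khintchine_lower:
  assumes "finite B" "\<And>n. n \<in> B \<Longrightarrow> norm (z n) = 1"
  shows "(\<Sum>S\<in>Pow B. norm (signed_sum z B S)) \<ge> 2 ^ card B * (9 / 16 * sqrt (card B))"
proof (cases "B = {}")
  case True
  then show ?thesis by simp
next
  case False
  define r where "r = sqrt (card B)"
  have r: "r > 0" "r\<^sup>2 = card B"
    using False assms(1) by (auto simp: r_def card_gt_0_iff)
  have r4: "r ^ 4 = (real (card B))\<^sup>2"
    unfolding r(2)[symmetric] by (simp flip: power_mult)
  let ?T = "\<lambda>S. norm (signed_sum z B S)"
  \<comment> \<open>After scaling by \<open>r\<close>, the mean square is 1 and the mean fourth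
    power is at most 3. The averaged \<open>tangent_bound\<close> therefore gives 3/4 - 3/16 =
    9/16.\<close>
  have "2 ^ card B * (9 / 16) \<le> 3 / 4 * (2 ^ card B * real (card B)) / r\<^sup>2
      - 2 ^ card B * (3 * (real (card B))\<^sup>2) / r ^ 4 / 16"
    using r False assms(1) unfolding r4 by (simp add: card_gt_0_iff)
  also have "\<dots> \<le> 3 / 4 * (\<Sum>S\<in>Pow B. (?T S)\<^sup>2) / r\<^sup>2 - (\<Sum>S\<in>Pow B. ?T S ^ 4) / r ^ 4 / 16"
    using sum_signed_sum_power2[of B z, OF assms] sum_signed_sum_power4_le[of B z, OF assms] r
    by (intro diff_mono divide_right_mono) auto
  also have "\<dots> = (\<Sum>S\<in>Pow B. 3 / 4 * (?T S / r)\<^sup>2 - (?T S / r) ^ 4 / 16)"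
    by (simp add: sum_subtractf sum_distrib_left sum_divide_distrib power_divide)
  also have "\<dots> \<le> (\<Sum>S\<in>Pow B. ?T S / r)"
    using r by (intro sum_mono tangent_bound) simp
  also have "\<dots> = (\<Sum>S\<in>Pow B. ?T S) / r"
    by (simp add: sum_divide_distrib)
  finally show ?thesis
    using r(1) unfolding r_def[symmetric] by (simp add: pos_le_divide_eq mult.assoc)
qed

text \<open>Since \<open>T\<close> and \<open>-T\<close> have the same distribution,
  \<open>norm (w + T) + norm (w - T) \<ge> 2 * norm T\<close> shows that a shift does not decrease the mean.\<close>

lemma khintchine_lower_shift:
  assumes "finite B" "\<And>n. n \<in> B \<Longrightarrow> norm (z n) = 1"
  shows "(\<Sum>S\<in>Pow B. norm (w + signed_sum z B S)) \<ge> 2 ^ card B * (9 / 16 * sqrt (card B))"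
proof -
  have "(\<Sum>S\<in>Pow B. norm (w + signed_sum z B S)) = (\<Sum>S\<in>Pow B. norm (w + signed_sum z B (B - S)))"
    by (rule sum.reindex_bij_witness[of _ "\<lambda>S. B - S" "\<lambda>S. B - S"]) (auto simp: double_diff)
  also have "\<dots> = (\<Sum>S\<in>Pow B. norm (w - signed_sum z B S))"
    by (rule sum.cong) (simp_all add: signed_sum_Compl)
  finally have "2 * (\<Sum>S\<in>Pow B. norm (w + signed_sum z B S))
      = (\<Sum>S\<in>Pow B. norm (w + signed_sum z B S) + norm (w - signed_sum z B S))"
    by (simp add: sum.distrib)
  also have "\<dots> \<ge> (\<Sum>S\<in>Pow B. 2 * norm (signed_sum z B S))"
  proof (rule sum_mono)
    fix S
    have "norm (2 * signed_sum z B S) \<le> norm (w + signed_sum z B S) + norm (w - signed_sum z B S)"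
      using norm_triangle_ineq4[of "w + signed_sum z B S" "w - signed_sum z B S"] by simp
    then show "2 * norm (signed_sum z B S)
        \<le> norm (w + signed_sum z B S) + norm (w - signed_sum z B S)"
      by (simp add: norm_mult)
  qed
  finally show ?thesis
    using khintchine_lower[of B z, OF assms] by (simp flip: sum_distrib_left)
qed

section \<open>Parseval's identity and the norms of the Fourier transform\<close>

lemma integral_cos_2pi_int:
  fixes k :: int
  shows "((\<lambda>x. cos (2 * pi * of_int k * x)) has_integral (of_bool (k = 0))) {0..1::real}"
proof (cases "k = 0")
  case True
  then show ?thesis using has_integral_const_real[of 1 0 1] by simp
next
  case False
  let ?F = "\<lambda>x. sin (2 * pi * of_int k * x) / (2 * pi * of_int k)"
  have "((\<lambda>x. cos (2 * pi * of_int k * x)) has_integral (?F 1 - ?F 0)) {0..1}"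
  proof (rule fundamental_theorem_of_calculus)
    fix x :: real
    have "(?F has_real_derivative cos (2 * pi * of_int k * x)) (at x within {0..1})"
      using False by (auto intro!: derivative_eq_intros)
    then show "(?F has_vector_derivative cos (2 * pi * of_int k * x)) (at x within {0..1})"
      by (simp add: has_real_derivative_iff_has_vector_derivative)
  qed simp
  moreover have "sin (2 * pi * of_int k) = 0"
    using sin_zero_iff_int2[of "2 * pi * of_int k"] by (auto intro!: exI[of _ "2 * k"])
  ultimately show ?thesis using False by simp
qed

text \<open>Writing the squared norm as a real inner product turns the cross terms into cosines of
  integer frequency \<open>n - k\<close>. Their integrals vanish off the diagonal.\<close>

lemma parseval_trig_poly:
  fixes a :: "nat \<Rightarrow> real"
  assumes "finite I"
  shows "((\<lambda>x. (norm (\<Sum>n\<in>I. of_real (a n) * cis (- 2 * pi * of_nat n * x)))\<^sup>2)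
           has_integral (\<Sum>n\<in>I. (a n)\<^sup>2)) {0..1}"
proof -
  have "(norm (\<Sum>n\<in>I. of_real (a n) * cis (- 2 * pi * of_nat n * x)))\<^sup>2
      = (\<Sum>n\<in>I. \<Sum>k\<in>I. a n * a k * cos (2 * pi * of_int (int n - int k) * x))" for x
  proof -
    let ?t = "\<lambda>n. - 2 * pi * real n * x"
    have "(norm (\<Sum>n\<in>I. of_real (a n) * cis (?t n)))\<^sup>2
        = (\<Sum>n\<in>I. \<Sum>k\<in>I. a n * a k * (cis (?t n) \<bullet> cis (?t k)))"
      by (simp add: power2_norm_eq_inner inner_sum_left inner_sum_right sum_distrib_left
          mult_ac inner_commute
          flip: scaleR_conv_of_real)
    moreover have "cis (?t n) \<bullet> cis (?t k) = cos (2 * pi * of_int (int n - int k) * x)" for n k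
    proof -
      have "cis (?t n) \<bullet> cis (?t k) = cos (?t n - ?t k)"
        by (simp add: inner_complex_def cos_diff)
      also have "\<dots> = cos (- (2 * pi * of_int (int n - int k) * x))"
        by (rule arg_cong[of _ _ cos]) (simp add: algebra_simps)
      finally show ?thesis by (simp only: cos_minus)
    qed
    ultimately show ?thesis by simp
  qed
  moreover have "((\<lambda>x. \<Sum>n\<in>I. \<Sum>k\<in>I. a n * a k * cos (2 * pi * of_int (int n - int k) * x))
      has_integral (\<Sum>n\<in>I. \<Sum>k\<in>I. a n * a k * of_bool (int n - int k = 0))) {0..1}"
    by (intro has_integral_sum has_integral_mult_right integral_cos_2pi_int assms)
  moreover have "(\<Sum>n\<in>I. \<Sum>k\<in>I. a n * a k * of_bool (int n - int k = 0)) = (\<Sum>n\<in>I. (a n)\<^sup>2)"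
    using assms by (intro sum.cong refl) (simp add: of_bool_def power2_eq_square sum.delta' if_distrib cong: if_cong)
  ultimately show ?thesis by simp
qed

lemma X'_eq: "X' R = {n \<in> {1..R}. squarefree n}"
  by (auto simp: X'_def moebius_def)

lemma finite_X' [simp]: "finite (X' R)"
  by (simp add: X'_eq)

lemma fourier_eq_sum_cis:
  "fourier R f x = (\<Sum>n\<in>X' R. of_int (f n) * cis (- 2 * pi * of_nat n * x))"
  unfolding fourier_def
  by (rule sum.mono_neutral_cong_right)
    (auto simp: X'_def extend_zero_def cis_conv_exp mult_ac)

lemma continuous_on_fourier: "continuous_on S (fourier R f)"
  unfolding fourier_eq_sum_cis[abs_def] by (intro continuous_intros)

lemma L1_norm_fourier: "L1_norm (fourier R f) = integral {0..1} (\<lambda>x. norm (fourier R f x))"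
  unfolding L1_norm_def
  by (intro set_borel_integral_eq_integral borel_integrable_atLeastAtMost'
      continuous_intros continuous_on_fourier)

lemma L2_norm_fourier:
  assumes "f \<in> sign_functions R"
  shows "L2_norm (fourier R f) = sqrt (card (X' R))"
proof -
  have "(LINT x:{0..1}|lborel. (norm (fourier R f x))\<^sup>2)
      = integral {0..1} (\<lambda>x. (norm (fourier R f x))\<^sup>2)"
    by (intro set_borel_integral_eq_integral borel_integrable_atLeastAtMost'
        continuous_intros continuous_on_fourier)
  also have "\<dots> = (\<Sum>n\<in>X' R. (of_int (f n))\<^sup>2)"
    using parseval_trig_poly[OF finite_X'[of R], of "\<lambda>n. of_int (f n)"]
    by (intro integral_unique) (simp add: fourier_eq_sum_cis)
  also have "\<dots> = (\<Sum>n\<in>X' R. 1)"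
    using assms by (intro sum.cong) (auto simp: sign_functions_def PiE_iff power2_eq_1_iff)
  finally show ?thesis
    by (simp add: L2_norm_def)
qed

section \<open>Shattering by functions of large Fourier ratio\<close>

lemma ex_hypothesis_with_labels:
  assumes "A \<subseteq> X' R" "2 * card A \<le> card (X' R)" "X' R \<noteq> {}" "S \<subseteq> A" "\<eta> \<le> 1 / 4"
  shows "\<exists>f\<in>hypotheses R \<eta>. \<forall>n\<in>A. f n = signs S n"
proof -
  \<comment> \<open>The labels on \<open>A\<close> are prescribed by \<open>S\<close>; those on the
    complement \<open>B\<close> are free, and \<open>T\<close> is the set of free points labelled
    +1.\<close>
  define B where "B = X' R - A"
  define f where "f T = restrict (signs (S \<union> T)) (X' R)" for T
  let ?z = "\<lambda>x n. cis (- 2 * pi * of_nat n * x)"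
  let ?L = "\<lambda>T. L1_norm (fourier R (f T))"
  have fin: "finite A" "finite B"
    using finite_subset[OF assms(1)] by (auto simp: B_def)
  have cB: "card (X' R) = card A + card B"
    using assms(1) fin by (simp add: B_def card_Diff_subset card_mono)
  have sf: "f T \<in> sign_functions R" for T
    by (auto simp: f_def sign_functions_def signs_def)
  have split: "fourier R (f T) x = signed_sum (?z x) A S + signed_sum (?z x) B T"
    if "T \<subseteq> B" for T x
  proof -
    have "fourier R (f T) x = (\<Sum>n\<in>A \<union> B. of_int (f T n) * ?z x n)"
      using assms(1) by (simp add: fourier_eq_sum_cis B_def Un_absorb1)
    also have "\<dots> = (\<Sum>n\<in>A. of_int (f T n) * ?z x n) + (\<Sum>n\<in>B. of_int (f T n) * ?z x n)"
      using fin by (intro sum.union_disjoint) (auto simp: B_def)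
    also have "(\<Sum>n\<in>A. of_int (f T n) * ?z x n) = signed_sum (?z x) A S"
      unfolding signed_sum_def using assms that
      by (intro sum.cong) (auto simp: f_def signs_def B_def)
    also have "(\<Sum>n\<in>B. of_int (f T n) * ?z x n) = signed_sum (?z x) B T"
      unfolding signed_sum_def using assms that
      by (intro sum.cong) (auto simp: f_def signs_def B_def)
    finally show ?thesis .
  qed
  have int: "(\<lambda>x. norm (fourier R (f T) x)) integrable_on {0..1}" for T
    by (intro integrable_continuous_interval continuous_intros continuous_on_fourier)
  \<comment> \<open>At each frequency \<open>x\<close> the contribution of \<open>A\<close> is a
    fixed shift of a random signed sum over \<open>B\<close>, so the shifted Khintchine bound holds
    pointwise. Integrating it bounds the sum of the \<open>L1_norm\<close> values over all
    \<open>T\<close>.\<close>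
  have "2 ^ card B * (9 / 16 * sqrt (card B))
      = integral {0..1} (\<lambda>x::real. 2 ^ card B * (9 / 16 * sqrt (card B)))"
    by simp
  also have "\<dots> \<le> integral {0..1} (\<lambda>x. \<Sum>T\<in>Pow B. norm (fourier R (f T) x))"
  proof (rule integral_le)
    fix x :: real
    have "2 ^ card B * (9 / 16 * sqrt (card B))
        \<le> (\<Sum>T\<in>Pow B. norm (signed_sum (?z x) A S + signed_sum (?z x) B T))"
      using fin by (intro khintchine_lower_shift) auto
    then show "2 ^ card B * (9 / 16 * sqrt (card B)) \<le> (\<Sum>T\<in>Pow B. norm (fourier R (f T) x))"
      by (simp add: split)
  qed (use int fin in \<open>auto intro!: integrable_sum\<close>)
  also have "\<dots> = (\<Sum>T\<in>Pow B. ?L T)"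
    using int fin by (simp add: integral_sum L1_norm_fourier)
  finally obtain T where T: "T \<subseteq> B" "?L T \<ge> 9 / 16 * sqrt (card B)"
    using ex_ge_average_Pow[OF fin(2)] by blast
  \<comment> \<open>At least half of \<open>X' R\<close> lies in \<open>B\<close>. The cruder factor
    4 has a rational root, and 9/32 still exceeds 1/4.\<close>
  have "sqrt (card (X' R)) \<le> sqrt (4 * card B)"
    using cB assms(2) by simp
  then have "sqrt (card (X' R)) \<le> 2 * sqrt (card B)" "sqrt (card B) \<ge> 0"
    by (simp_all add: real_sqrt_mult)
  then have "1 / 4 * sqrt (card (X' R)) \<le> 9 / 16 * sqrt (card B)"
    by linarith
  moreover have "sqrt (card (X' R)) > 0"
    using assms(3) by (simp add: card_gt_0_iff)
  ultimately have "1 / 4 \<le> FR R (f T)"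
    using T unfolding FR_def L2_norm_fourier[OF sf] by (subst pos_le_divide_eq) linarith+
  then have "f T \<in> hypotheses R \<eta>"
    using assms(5) sf by (simp add: hypotheses_def)
  moreover have "f T n = signs S n" if "n \<in> A" for n
    using that assms(1) T(1) by (auto simp: f_def signs_def B_def)
  ultimately show ?thesis by blast
qed

section \<open>Density of the squarefree integers\<close>

lemma card_dvd_atLeastAtMost_le:
  assumes "q > 0"
  shows "card {n \<in> {1..R}. q dvd n} \<le> R div q"
proof -
  have "{n \<in> {1..R}. q dvd n} \<subseteq> (\<lambda>k. q * k) ` {1..R div q}"
    using assms by (force elim!: dvdE simp: less_eq_div_iff_mult_less_eq mult.commute)
  then have "card {n \<in> {1..R}. q dvd n} \<le> card ((\<lambda>k. q * k) ` {1..R div q})"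
    by (intro card_mono) auto
  also have "\<dots> \<le> R div q"
    using card_image_le[of "{1..R div q}" "\<lambda>k. q * k"] by simp
  finally show ?thesis .
qed

text \<open>Each new term is at most 1/n - 1/(n + 1), so the sum telescopes. The term 1/4 at
  \<open>d = 2\<close> is kept exact: telescoping from there as well would give the bound 1 - 1/n,
  too weak for a positive density.\<close>

lemma sum_inverse_squares_le:
  "n \<ge> 2 \<Longrightarrow> (\<Sum>d=2..n. 1 / (real d)\<^sup>2) \<le> 3 / 4 - 1 / real n"
proof (induction n rule: nat_induct_at_least)
  case base
  then show ?case by simp
next
  case (Suc n)
  have "1 / (real (Suc n))\<^sup>2 \<le> 1 / (real n * real (Suc n))"
    using Suc.hyps unfolding power2_eq_square
    by (intro divide_left_mono mult_right_mono mult_pos_pos) simp_all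
  also have "\<dots> = 1 / real n - 1 / real (Suc n)"
    using Suc.hyps by (simp add: diff_frac_eq)
  finally have "1 / (real (Suc n))\<^sup>2 \<le> 1 / real n - 1 / real (Suc n)" .
  then show ?case using Suc by simp
qed

text \<open>A non-squarefree integer up to \<open>R\<close> is a multiple of the square of some
  \<open>d\<close> with 2 \<le> d \<le> R. The union bound over \<open>d\<close> discards at most
  3/4 of the integers.\<close>

lemma card_X'_ge: "real (card (X' R)) \<ge> real R / 4"
proof (cases "R \<ge> 2")
  case True
  have sub: "X' R \<subseteq> {1..R}"
    by (auto simp: X'_eq)
  let ?M = "\<lambda>d. {n \<in> {1..R}. d\<^sup>2 dvd n}"
  have "{1..R} - X' R \<subseteq> (\<Union>d\<in>{2..R}. ?M d)"
  proof
    fix n assume "n \<in> {1..R} - X' R"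
    then have n: "1 \<le> n" "n \<le> R" "\<not> squarefree n"
      by (auto simp: X'_eq)
    then obtain d where d: "d\<^sup>2 dvd n" "d \<noteq> 1"
      by (auto simp: squarefree_def)
    then have "d \<noteq> 0" "d\<^sup>2 \<le> n"
      using n by (auto intro: dvd_imp_le intro!: Nat.gr0I)
    then have "d \<le> n"
      using power2_nat_le_imp_le by blast
    with d n \<open>d \<noteq> 0\<close> show "n \<in> (\<Union>d\<in>{2..R}. ?M d)"
      by auto
  qed
  then have "card ({1..R} - X' R) \<le> card (\<Union>d\<in>{2..R}. ?M d)"
    by (intro card_mono) auto
  also have "\<dots> \<le> (\<Sum>d\<in>{2..R}. card (?M d))"
    by (intro card_UN_le) auto
  also have "real \<dots> \<le> (\<Sum>d\<in>{2..R}. real R * (1 / (real d)\<^sup>2))"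
    unfolding of_nat_sum
  proof (rule sum_mono)
    fix d assume "d \<in> {2..R}"
    then have "real (card (?M d)) \<le> real (R div d\<^sup>2)"
      by (intro of_nat_mono card_dvd_atLeastAtMost_le) auto
    also have "\<dots> \<le> real R * (1 / (real d)\<^sup>2)"
      using of_nat_div_le_of_nat[of R "d\<^sup>2"] by simp
    finally show "real (card (?M d)) \<le> real R * (1 / (real d)\<^sup>2)" .
  qed
  also have "\<dots> \<le> real R * (3 / 4 - 1 / real R)"
    unfolding sum_distrib_left[symmetric]
    using sum_inverse_squares_le[OF True] by (intro mult_left_mono) simp_all
  also have "\<dots> \<le> real R * (3 / 4)"
    by (intro mult_left_mono) simp_all
  finally have "real (card ({1..R} - X' R)) \<le> real R * (3 / 4)" 
    by simp
  moreover have "card ({1..R} - X' R) = R - card (X' R)" "card (X' R) \<le> R"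
    using card_mono[OF _ sub] card_Diff_subset[OF _ sub] by simp_all
  ultimately show ?thesis by (simp add: of_nat_diff)
next
  case False
  then consider "R = 0" | "R = 1" by linarith
  then show ?thesis
  proof cases
    case 2
    then have "1 \<in> X' R" by (simp add: X'_eq)
    then have "card (X' R) > 0" by (auto simp: card_gt_0_iff)
    then show ?thesis using 2 by simp
  qed simp
qed

section \<open>Lower bound on the number of samples\<close>

lemma prob_bind_pmf:
  "measure_pmf.prob (bind_pmf P K) E = measure_pmf.expectation P (\<lambda>x. measure_pmf.prob (K x) E)"
proof -
  \<comment> \<open>Pushing forward along membership in \<open>E\<close> makes the probability a
    point mass, to which \<open>pmf_bind\<close> applies.\<close>
  have *: "measure_pmf.prob M E = pmf (map_pmf (\<lambda>h. h \<in> E) M) True" for M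
    by (simp add: pmf_map vimage_def)
  show ?thesis
    unfolding * by (simp add: map_bind_pmf pmf_bind)
qed

lemma no_free_lunch:
  fixes target :: "nat set \<Rightarrow> nat \<Rightarrow> int"
  assumes "finite A" "A \<noteq> {}" "2 * m \<le> card A"
    and target: "\<And>S n. S \<subseteq> A \<Longrightarrow> n \<in> A \<Longrightarrow> target S n = signs S n"
  shows "\<exists>S\<subseteq>A. measure_pmf.prob (output_law m alg (pmf_of_set A) (target S))
           {h. error (pmf_of_set A) (target S) h \<ge> 1 / 4} \<ge> 1 / 2"
proof -
  define bad where "bad S = {h. error (pmf_of_set A) (target S) h \<ge> 1 / 4}" for S
  define p where
    "p S ns = measure_pmf.prob (alg (map (\<lambda>n. (n, target S n)) ns)) (bad S)" for S ns
  let ?P = "replicate_pmf m (pmf_of_set A)"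
  let ?N = "{ns. set ns \<subseteq> A \<and> length ns = m}"
  have supp: "set_pmf ?P = ?N"
    using assms(1,2) by (auto simp: set_replicate_pmf lists_eq_set)
  have fin: "finite (set_pmf ?P)"
    unfolding supp using assms(1) by (rule finite_lists_length_eq)
  \<comment> \<open>For fixed sample points the labellings are paired by an involution. The two
    failure probabilities in a pair sum to at least 1, hence average at least 1/2.\<close>
  have pointwise: "(\<Sum>S\<in>Pow A. p S ns) \<ge> 2 ^ card A * (1 / 2)" if ns: "ns \<in> ?N" for ns
  proof -
    define U where "U = A - set ns"
    \<comment> \<open>Flipping the labels of the unseen points does not change the sample.\<close>
    define flip where "flip S = (S - U) \<union> (U - S)" for S
    have UA: "U \<subseteq> A" and flip_sub: "flip S \<subseteq> A" if "S \<subseteq> A" for S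
      using that by (auto simp: U_def flip_def)
    have flip_flip: "flip (flip S) = S" for S
      by (auto simp: flip_def)
    have "card (set ns) \<le> m"
      using ns card_length[of ns] by simp
    then have cU: "2 * card U \<ge> card A"
      using assms(3) ns by (simp add: U_def card_Diff_subset)
    have pair: "p S ns + p (flip S) ns \<ge> 1" if S: "S \<subseteq> A" for S
    proof -
      have eq: "map (\<lambda>n. (n, target (flip S) n)) ns = map (\<lambda>n. (n, target S n)) ns"
        using ns S flip_sub[OF S] by (auto simp: target signs_def flip_def U_def)
      \<comment> \<open>The two targets disagree throughout \<open>U\<close>, so \<open>h\<close>
        errs at each point of \<open>U\<close> for one of them. One of the two error sets thus has
        at least half of \<open>card U\<close> points, a quarter of \<open>card A\<close>.\<close>
      have "h \<in> bad S \<union> bad (flip S)" for h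
      proof -
        let ?E = "\<lambda>S. A \<inter> {n. h n \<noteq> target S n}"
        have "U \<subseteq> ?E S \<union> ?E (flip S)"
        proof
          fix n assume "n \<in> U"
          then have "n \<in> A" "target S n \<noteq> target (flip S) n"
            using S flip_sub[OF S] by (auto simp: target signs_def flip_def U_def)
          then show "n \<in> ?E S \<union> ?E (flip S)" by auto
        qed
        then have "card U \<le> card (?E S \<union> ?E (flip S))"
          using assms(1) by (intro card_mono) auto
        also have "\<dots> \<le> card (?E S) + card (?E (flip S))"
          by (rule card_Un_le)
        finally have "card A \<le> 4 * card (?E S) \<or> card A \<le> 4 * card (?E (flip S))"
          using cU by linarith
        moreover have "h \<in> bad T" if "card A \<le> 4 * card (?E T)" for T
        proof -
          have "card A > 0" using assms by (simp add: card_gt_0_iff)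
          then show ?thesis
            using that assms(1,2) by (simp add: bad_def error_def measure_pmf_of_set field_simps)
        qed
        ultimately show ?thesis by blast
      qed
      then have "bad S \<union> bad (flip S) = UNIV" by blast
      \<comment> \<open>Both targets feed the learner the same labelled sample, so a single output
        law covers both bad events and subadditivity applies.\<close>
      then have "1 = measure_pmf.prob (alg (map (\<lambda>n. (n, target S n)) ns)) (bad S \<union> bad (flip S))"
        by simp
      also have "\<dots> \<le> p S ns + p (flip S) ns"
        unfolding p_def eq by (intro measure_Un_le) auto
      finally show ?thesis .
    qed
    have "(\<Sum>S\<in>Pow A. p (flip S) ns) = (\<Sum>S\<in>Pow A. p S ns)"
      using flip_sub flip_flip
      by (intro sum.reindex_bij_witness[of _ flip flip]) auto
    then have "2 * (\<Sum>S\<in>Pow A. p S ns) = (\<Sum>S\<in>Pow A. p S ns + p (flip S) ns)"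
      by (simp add: sum.distrib)
    also have "\<dots> \<ge> (\<Sum>S\<in>Pow A. 1)"
      using pair by (intro sum_mono) auto
    finally show ?thesis
      using assms(1) by (simp add: card_Pow)
  qed
  \<comment> \<open>The pointwise bound is averaged over the sample points. Exchanging this with the
    sum over labellings yields one labelling, chosen independently of the sample, that fails with
    probability at least 1/2.\<close>
  have "2 ^ card A * (1 / 2) = measure_pmf.expectation ?P (\<lambda>ns. 2 ^ card A * (1 / 2 :: real))"
    by simp
  also have "\<dots> \<le> measure_pmf.expectation ?P (\<lambda>ns. \<Sum>S\<in>Pow A. p S ns)"
    using pointwise supp fin
    by (intro integral_mono_AE integrable_measure_pmf_finite) (auto simp: AE_measure_pmf_iff)
  also have "\<dots> = (\<Sum>S\<in>Pow A. measure_pmf.expectation ?P (p S))"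
    using fin by (intro Bochner_Integration.integral_sum integrable_measure_pmf_finite)
  finally obtain S where "S \<subseteq> A" "measure_pmf.expectation ?P (p S) \<ge> 1 / 2"
    using ex_ge_average_Pow[OF assms(1)] by blast
  then show ?thesis
    unfolding output_law_def prob_bind_pmf p_def[abs_def] bad_def by blast
qed

lemma sample_lower_bound:
  assumes "\<eta> \<le> 1 / 4" "R \<ge> 8"
    and success: "\<And>D. set_pmf D \<subseteq> X' R \<Longrightarrow>
      (SUP target \<in> hypotheses R \<eta>.
        measure_pmf.prob (output_law m alg D target) {h. error D target h \<ge> 1/4}) \<le> 1/3"
  shows "real m \<ge> 1 / 32 * real R"
proof (rule ccontr)
  assume "\<not> ?thesis"
  then have m: "32 * real m < real R" by simp
  define d where "d = card (X' R) div 2"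
  have N: "real (card (X' R)) \<ge> real R / 4"
    by (rule card_X'_ge)
  \<comment> \<open>\<open>R \<ge> 8\<close> gives \<open>card (X' R) \<ge> 2\<close>, so
    \<open>d\<close> is positive. From 32m < R the cardinality exceeds 8m, whence \<open>d\<close>
    is at least 4m.\<close>
  have "d \<ge> 1" "2 * m \<le> d"
    using N m assms(2) unfolding d_def by linarith+
  obtain A where A: "A \<subseteq> X' R" "card A = d"
    using obtain_subset_with_card_n[of d "X' R"] by (auto simp: d_def)
  have finA: "finite A" "A \<noteq> {}"
    using A \<open>d \<ge> 1\<close> finite_subset[OF A(1)] by auto
  then have "X' R \<noteq> {}" using A by auto
  then have "\<forall>S. \<exists>f. S \<subseteq> A \<longrightarrow> f \<in> hypotheses R \<eta> \<and> (\<forall>n\<in>A. f n = signs S n)"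
    using ex_hypothesis_with_labels[OF A(1)] A(2) assms(1) by (auto simp: d_def Bex_def)
  then obtain target where target:
    "\<And>S. S \<subseteq> A \<Longrightarrow> target S \<in> hypotheses R \<eta>"
    "\<And>S n. S \<subseteq> A \<Longrightarrow> n \<in> A \<Longrightarrow> target S n = signs S n"
    by metis
  let ?D = "pmf_of_set A"
  let ?p = "\<lambda>t. measure_pmf.prob (output_law m alg ?D t) {h. error ?D t h \<ge> 1/4}"
  obtain S where S: "S \<subseteq> A" "?p (target S) \<ge> 1 / 2"
    using no_free_lunch[OF finA _ target(2)] A(2) \<open>2 * m \<le> d\<close> by metis
  \<comment> \<open>A supremum of reals dominates its members only when the family is bounded above;
    here 1 bounds all probabilities. The contradiction is 1/2 \<le> 1/3.\<close>
  have "?p (target S) \<le> (SUP t \<in> hypotheses R \<eta>. ?p t)"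
    using target(1)[OF S(1)] by (intro cSUP_upper bdd_aboveI[of _ 1]) auto
  also have "\<dots> \<le> 1 / 3"
    using A(1) finA by (intro success) simp
  finally show False using S(2) by simp
qed

theorem theorem1p7:
  shows "\<exists>c::real. c > 0 \<and>
    (\<forall>\<eta> :: nat \<Rightarrow> real.
      (\<forall>R\<ge>1. \<eta> R > 0) \<longrightarrow>
      \<eta> \<longlonglongrightarrow> 0 \<longrightarrow>
      (\<forall>\<^sub>F R in sequentially. moebius_restr R \<in> hypotheses R (\<eta> R)) \<longrightarrow>
      (\<forall>\<^sub>F R in sequentially.
        \<forall>(m::nat) A.
          learning_algorithm R m A \<longrightarrow>
          (\<forall>D. set_pmf D \<subseteq> X' R \<longrightarrow>
             (SUP target \<in> hypotheses R (\<eta> R).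
                measure_pmf.prob (output_law m A D target) {h. error D target h \<ge> 1/4}) \<le> 1/3) \<longrightarrow>
          real m \<ge> c * real R))"
proof (intro exI[of _ "1 / 32"] conjI allI impI)
  fix \<eta> :: "nat \<Rightarrow> real"
  assume "\<eta> \<longlonglongrightarrow> 0"
  \<comment> \<open>The threshold 1/4 is the Fourier ratio guaranteed by the shattering argument.
    Together with \<open>R \<ge> 8\<close> it determines how large \<open>R\<close> must be.\<close>
  then have "\<forall>\<^sub>F R in sequentially. \<eta> R < 1 / 4"
    by (rule order_tendstoD) simp
  then show "\<forall>\<^sub>F R in sequentially.
        \<forall>(m::nat) A.
          learning_algorithm R m A \<longrightarrow>
          (\<forall>D. set_pmf D \<subseteq> X' R \<longrightarrow>
             (SUP target \<in> hypotheses R (\<eta> R).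
                measure_pmf.prob (output_law m A D target) {h. error D target h \<ge> 1/4}) \<le> 1/3) \<longrightarrow>
          real m \<ge> 1 / 32 * real R"
    using eventually_ge_at_top[of 8]
  proof eventually_elim
    case (elim R)
    then show ?case
      using sample_lower_bound[of "\<eta> R" R] by auto
  qed
qed simp

end
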